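(* Fix $0<t\le 1$ and let $k=k_n=[nt]$. Suppose $E\varepsilon_0^2=1$, $E\varepsilon_0^4<\infty$, and, as $n\to\infty$, $n^{1/2}\alpha_n\to 0$, $n\alpha_n\to\infty$ and $n^{1/2}\gamma_n\to 0$. Then there exist random variables $R_k^{(1)}$, $R_{k,j}^{(2)}$ and $R_{k,j}^{(3)}$ such that $$\sigma_k^2=\sigma_0^2e^{k\gamma}\Big(1+\alpha\sum_{1\le j\le k}\xi_{k-j}+R_k^{(1)}\Big)+\omega\Big[1+\sum_{1\le j\le k-1}e^{j\gamma}\Big(1+\alpha\sum_{1\le i\le j}\xi_{k-i}+R_{k,j}^{(2)}\Big)\big(1+R_{k,j}^{(3)}\big)\Big],$$ and, as $n\to\infty$, $$|R_k^{(1)}|=O_P\big(k(\alpha^2+\gamma^2)\big),\qquad \max_{1\le j\le k}|R_{k,j}^{(2)}|=O_P(k\alpha^2),$$ $$\max_{1\le j\le k}\frac{1}{j\log\log j}|R_{k,j}^{(2)}|=O_P(\alpha^2),\qquad \max_{1\le j\le k}\frac1j|R_{k,j}^{(3)}|=O_P(\alpha^2+\gamma^2).$$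
   Context: Let $\varepsilon_0,\varepsilon_1,\varepsilon_2,\dots$ be independent identically distributed real random variables (not necessarily of mean zero) such that the distribution of $\varepsilon_0^2$ is nondegenerate. Let $\omega>0$ be a constant. For each $n\ge1$ let $\alpha=\alpha_n\ge0$ and $\beta=\beta_n\ge0$ be real numbers with $\alpha_n\to0$ and $\beta_n\to1$ as $n\to\infty$. Given an initial value $\sigma_0$ (a fixed real number not depending on $n$) and $y_0=\sigma_0\varepsilon_0$, define for each $n$ the sequences $\sigma_k\ge 0$ and $y_k$, $1\le k\le n$ (which depend on $n$ through $\alpha_n,\beta_n$), by $y_k=\sigma_k\varepsilon_k$ and $\sigma_k^2=\omega+\alpha y_{k-1}^2+\beta\sigma_{k-1}^2$. Put $\gamma=\gamma_n=\alpha_n+\beta_n-1$ and $\xi_j=\varepsilon_j^2-1$. $[x]$ denotes the integer part of $x$. By convention $\log\log x=1$ if $x<4$. The symbols $O_P$, $o_P$ refer to $n\to\infty$ with $t$ fixed. *)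

theory Defs
  imports "HOL-Probability.Probability"
begin

text \<open>A degenerate distribution on the line is a point mass.\<close>

definition nondegenerate_distribution :: "real measure \<Rightarrow> bool" where
  "nondegenerate_distribution D \<longleftrightarrow> (\<forall>c. D \<noteq> return borel c)"

text \<open>\<open>X n = O_P(a n)\<close> as \<open>n\<close> tends to infinity: the ratios \<open>X n / a n\<close> are asymptotically
  bounded in probability.  The condition is meant for measurable \<open>X n\<close>, since \<^const>\<open>measure\<close>
  returns \<open>0\<close> on non-measurable sets.\<close>

definition bigO_P :: "'a measure \<Rightarrow> (nat \<Rightarrow> 'a \<Rightarrow> real) \<Rightarrow> (nat \<Rightarrow> real) \<Rightarrow> bool" where
  "bigO_P M X a \<longleftrightarrow>
     (\<forall>\<delta>>0. \<exists>C>0. \<forall>\<^sub>F n in sequentially.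
        measure M {x \<in> space M. \<bar>X n x\<bar> > C * \<bar>a n\<bar>} \<le> \<delta>)"

text \<open>The iterated logarithm, with the convention that it equals \<open>1\<close> below \<open>4\<close>.\<close>

definition loglog :: "real \<Rightarrow> real" where
  "loglog x = (if x < 4 then 1 else ln (ln x))"

end

theory Submission
  imports Defs
begin

text \<open>
  Iterating the recursion expresses \<open>\<sigma>\<^sub>k\<^sup>2\<close> through the products
  \<open>P\<^sub>j = \<Prod>\<^sub>i\<^sub>\<le>\<^sub>j (1 + \<gamma> + \<alpha> \<xi>\<^sub>k\<^sub>-\<^sub>i)\<close>.  With
  \<open>S\<^sub>j = \<Sum>\<^sub>i\<^sub>\<le>\<^sub>j \<xi>\<^sub>k\<^sub>-\<^sub>i\<close>, put \<open>R2 = exp (\<alpha> S\<^sub>j) - 1 - \<alpha> S\<^sub>j\<close>,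
  which is of order \<open>\<alpha>\<^sup>2 S\<^sub>j\<^sup>2\<close>, and
  \<open>1 + R3 = P\<^sub>j exp (- j \<gamma>) exp (- \<alpha> S\<^sub>j)\<close>, whose logarithm is of order
  \<open>j \<gamma>\<^sup>2 + \<alpha>\<^sup>2 V\<^sub>j\<close> for \<open>V\<^sub>j = \<Sum>\<^sub>i\<^sub>\<le>\<^sub>j \<xi>\<^sub>k\<^sub>-\<^sub>i\<^sup>2\<close>.
  So everything reduces to bounding \<open>V\<^sub>j / j\<close>, \<open>S\<^sub>j\<^sup>2 / k\<close> and \<open>S\<^sub>j\<^sup>2 / (j log log j)\<close> in
  probability, uniformly in \<open>j \<le> k\<close> and in \<open>k\<close>.  These are maxima over suffix sums of an i.i.d.
  sequence, and the maximum of all suffix sums obeys Lindley's recursion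
  \<open>L\<^sub>n\<^sub>+\<^sub>1 = max 0 (Z\<^sub>n + L\<^sub>n)\<close> with \<open>Z\<^sub>n\<close> independent of \<open>L\<^sub>n\<close>; this yields both a weak-type
  maximal inequality for \<open>V\<^sub>j / j\<close> and an exponential maximal inequality for
  \<open>\<theta> S\<^sub>j - \<theta>\<^sup>2 (V\<^sub>j + j E \<xi>\<^sup>2)\<close>.
\<close>

section \<open>Suffix sums and Lindley's recursion\<close>

primrec lindley :: "(nat \<Rightarrow> 'a \<Rightarrow> real) \<Rightarrow> nat \<Rightarrow> 'a \<Rightarrow> real" where
  "lindley Z 0 x = 0"
| "lindley Z (Suc n) x = max 0 (Z n x + lindley Z n x)"

lemma lindley_nonneg: "lindley Z n x \<ge> 0"
  by (cases n) auto

lemma sum_shift_reversed: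
  fixes f :: "nat \<Rightarrow> 'b::comm_monoid_add"
  shows "(\<Sum>i=1..Suc j. f (Suc n - i)) = f n + (\<Sum>i=1..j. f (n - i))"
proof -
  have "(\<Sum>i=1..Suc j. f (Suc n - i)) = f n + (\<Sum>i=Suc 1..Suc j. f (Suc n - i))"
    by (subst sum.atLeast_Suc_atMost) auto
  also have "(\<Sum>i=Suc 1..Suc j. f (Suc n - i)) = (\<Sum>i=1..j. f (n - i))"
    by (subst sum.atLeast_Suc_atMost_Suc_shift) simp
  finally show ?thesis .
qed

text \<open>A nonempty suffix is the newest term \<open>Z n\<close> plus a suffix of the earlier
  terms, and \<open>max 0\<close> accounts for the empty suffix, so the induction follows the
  recursion.\<close>

lemma suffix_sum_le_lindley:
  "j \<le> n \<Longrightarrow> (\<Sum>i=1..j. Z (n - i) x) \<le> lindley Z n x"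
proof (induction n arbitrary: j)
  case (Suc n)
  show ?case
  proof (cases j)
    case (Suc j')
    with Suc.prems Suc.IH[of j'] show ?thesis
      by (simp only: sum_shift_reversed[of "\<lambda>i. Z i x"]) auto
  qed simp
qed simp

lemma lindley_measurable [measurable]:
  assumes "\<And>i. i < n \<Longrightarrow> Z i \<in> borel_measurable N"
  shows "lindley Z n \<in> borel_measurable N"
  using assms
proof (induction n)
  case (Suc n)
  from Suc.IH Suc.prems have [measurable]: "lindley Z n \<in> borel_measurable N" "Z n \<in> borel_measurable N"
    by auto
  show ?case
    unfolding lindley.simps by measurable
qed (simp add: lindley.simps(1)[abs_def])

text \<open>Exhibits \<open>lindley Z m\<close> as a function of the first coordinates alone, the
  form in which independence of disjoint index blocks applies.\<close>

lemma lindley_restrict: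
  "m \<le> n \<Longrightarrow> lindley (\<lambda>i f. f i) m (\<lambda>i\<in>{..<n}. Z i x) = lindley Z m x"
  by (induction m) auto

section \<open>Independence and maximal inequalities for Lindley's recursion\<close>

context prob_space
begin

text \<open>\<open>lindley Z n\<close> involves only indices below \<open>n\<close>, a block
  disjoint from \<open>{n}\<close>. Both orders are recorded because
  \<open>nn_integral_indep_var\<close> integrates out the second component first: in one use this is
  \<open>Z n\<close>, in the other \<open>lindley Z n\<close>.\<close>

lemma indep_var_lindley:
  assumes "indep_vars (\<lambda>_. borel) Z UNIV"
  shows "indep_var borel (lindley Z n) borel (Z n)"
    and "indep_var borel (Z n) borel (lindley Z n)"
proof -
  let ?L = "\<lambda>f. lindley (\<lambda>i f. f i) n f"
  let ?P = "\<lambda>A. \<lambda>x. \<lambda>i\<in>A. Z i x"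
  have L: "?L \<in> borel_measurable (PiM {..<n} (\<lambda>_. borel))"
    by (rule lindley_measurable) simp
  have Z: "(\<lambda>f. f n) \<in> borel_measurable (PiM {n} (\<lambda>_. borel))"
    by simp
  have eq: "?L \<circ> ?P {..<n} = lindley Z n" "(\<lambda>f. f n) \<circ> ?P {n} = Z n"
    by (simp_all add: fun_eq_iff lindley_restrict)
  have "indep_var borel (?L \<circ> ?P {..<n}) borel ((\<lambda>f. f n) \<circ> ?P {n})"
    by (rule indep_var_compose[OF indep_var_restrict[OF assms] L Z]) auto
  then show "indep_var borel (lindley Z n) borel (Z n)"
    unfolding eq .
  have "indep_var borel ((\<lambda>f. f n) \<circ> ?P {n}) borel (?L \<circ> ?P {..<n})"
    by (rule indep_var_compose[OF indep_var_restrict[OF assms] Z L]) auto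
  then show "indep_var borel (Z n) borel (lindley Z n)"
    unfolding eq .
qed

lemma identically_distributed:
  fixes f :: "real \<Rightarrow> real"
  assumes [measurable]: "X \<in> borel_measurable M" "Y \<in> borel_measurable M"
    and eq: "distr M borel X = distr M borel Y"
    and [measurable]: "f \<in> borel_measurable borel"
  shows "integrable M (\<lambda>x. f (X x)) \<longleftrightarrow> integrable M (\<lambda>x. f (Y x))"
    and "expectation (\<lambda>x. f (X x)) = expectation (\<lambda>x. f (Y x))"
    and "distr M borel (\<lambda>x. f (X x)) = distr M borel (\<lambda>x. f (Y x))"
proof -
  show "integrable M (\<lambda>x. f (X x)) \<longleftrightarrow> integrable M (\<lambda>x. f (Y x))"
    using arg_cong[OF eq, of "\<lambda>N. integrable N f"] by (simp add: integrable_distr_eq)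
  show "expectation (\<lambda>x. f (X x)) = expectation (\<lambda>x. f (Y x))"
    using arg_cong[OF eq, of "\<lambda>N. integral\<^sup>L N f"] by (simp add: integral_distr)
  show "distr M borel (\<lambda>x. f (X x)) = distr M borel (\<lambda>x. f (Y x))"
    using arg_cong[OF eq, of "\<lambda>N. distr N borel f"] by (simp add: distr_distr comp_def)
qed

text \<open>Fubini on the product of the two laws, pulled back to \<open>M\<close> so that the inner
  integral can be read as a probability on \<open>M\<close> and meet an induction
  hypothesis.\<close>

lemma nn_integral_indep_var:
  assumes "indep_var S X T Y" and [measurable]: "f \<in> borel_measurable (S \<Otimes>\<^sub>M T)"
  shows "(\<integral>\<^sup>+x. f (X x, Y x) \<partial>M) = (\<integral>\<^sup>+x. (\<integral>\<^sup>+y. f (X x, Y y) \<partial>M) \<partial>M)"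
proof -
  have [measurable]: "X \<in> measurable M S" "Y \<in> measurable M T"
    and D: "distr M S X \<Otimes>\<^sub>M distr M T Y = distr M (S \<Otimes>\<^sub>M T) (\<lambda>x. (X x, Y x))"
    using assms(1) by (auto simp: indep_var_distribution_eq)
  interpret Y: prob_space "distr M T Y"
    by (rule prob_space_distr) simp
  have "(\<integral>\<^sup>+x. f (X x, Y x) \<partial>M) = integral\<^sup>N (distr M S X \<Otimes>\<^sub>M distr M T Y) f"
    unfolding D by (simp add: nn_integral_distr)
  also have "\<dots> = (\<integral>\<^sup>+u. \<integral>\<^sup>+v. f (u, v) \<partial>distr M T Y \<partial>distr M S X)"
    by (subst Y.nn_integral_fst[symmetric]) simp_all
  also have "\<dots> = (\<integral>\<^sup>+x. \<integral>\<^sup>+v. f (X x, v) \<partial>distr M T Y \<partial>M)"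
    by (subst nn_integral_distr) (simp_all add: measurable_compose[OF _ Y.borel_measurable_nn_integral])
  also have "\<dots> = (\<integral>\<^sup>+x. \<integral>\<^sup>+y. f (X x, Y y) \<partial>M \<partial>M)"
    by (intro nn_integral_cong, subst nn_integral_distr) simp_all
  finally show ?thesis .
qed

text \<open>Given \<open>Z n\<close>, the previous maximum has to reach the level
  \<open>b - Z n x\<close>. The induction hypothesis at that level, integrated with
  \<open>exp_le\<close>, restores \<open>exp (- b)\<close>. The level is random, hence the arbitrary
  \<open>b\<close> in the induction.\<close>

lemma emeasure_lindley_ge:
  assumes indep: "indep_vars (\<lambda>_. borel) Z UNIV"
    and exp_le: "\<And>i. (\<integral>\<^sup>+x. ennreal (exp (Z i x)) \<partial>M) \<le> 1"
  shows "emeasure M {x\<in>space M. b \<le> lindley Z n x} \<le> ennreal (exp (- b))"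
proof -
  have [measurable]: "Z i \<in> borel_measurable M" for i
    using indep by (auto simp: indep_vars_def)
  have trivial: "emeasure M A \<le> ennreal (exp (- b))" if "b \<le> 0" for A and b :: real
  proof -
    have "emeasure M A \<le> 1"
      by (rule emeasure_le_1)
    also have "1 \<le> ennreal (exp (- b))"
      using that by simp
    finally show ?thesis .
  qed
  show ?thesis
  proof (induction n arbitrary: b)
    case 0
    show ?case
      by (cases "b \<le> 0") (auto intro: trivial)
  next
    case (Suc n)
    show ?case
    proof (cases "b \<le> 0")
      case False
      let ?f = "\<lambda>p :: real \<times> real. indicator {p. b \<le> fst p + snd p} p :: ennreal"
      \<comment> \<open>For \<open>b > 0\<close> the value \<open>0\<close> in \<open>max 0\<close>
        cannot reach the level, so the event concerns the sum alone.\<close>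
      have "emeasure M {x\<in>space M. b \<le> lindley Z (Suc n) x}
          = emeasure M {x\<in>space M. b \<le> Z n x + lindley Z n x}"
        using False by (intro arg_cong[where f = "emeasure M"]) auto
      also have "\<dots> = (\<integral>\<^sup>+x. indicator {x\<in>space M. b \<le> Z n x + lindley Z n x} x \<partial>M)"
        by simp
      also have "\<dots> = (\<integral>\<^sup>+x. ?f (Z n x, lindley Z n x) \<partial>M)"
        by (intro nn_integral_cong) (auto simp: indicator_def)
      also have "\<dots> = (\<integral>\<^sup>+x. (\<integral>\<^sup>+y. ?f (Z n x, lindley Z n y) \<partial>M) \<partial>M)"
        by (rule nn_integral_indep_var[OF indep_var_lindley(2)[OF indep]]) measurable
      also have "\<dots> = (\<integral>\<^sup>+x. emeasure M {y\<in>space M. b - Z n x \<le> lindley Z n y} \<partial>M)"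
      proof (intro nn_integral_cong)
        fix x
        have "(\<integral>\<^sup>+y. ?f (Z n x, lindley Z n y) \<partial>M)
            = (\<integral>\<^sup>+y. indicator {y\<in>space M. b - Z n x \<le> lindley Z n y} y \<partial>M)"
          by (intro nn_integral_cong) (auto simp: indicator_def)
        then show "(\<integral>\<^sup>+y. ?f (Z n x, lindley Z n y) \<partial>M)
            = emeasure M {y\<in>space M. b - Z n x \<le> lindley Z n y}"
          by simp
      qed
      also have "\<dots> \<le> (\<integral>\<^sup>+x. ennreal (exp (- (b - Z n x))) \<partial>M)"
        by (intro nn_integral_mono Suc.IH)
      also have "\<dots> = (\<integral>\<^sup>+x. ennreal (exp (- b)) * ennreal (exp (Z n x)) \<partial>M)"
        by (intro nn_integral_cong) (simp add: exp_diff exp_minus field_simps flip: ennreal_mult)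
      also have "\<dots> = ennreal (exp (- b)) * (\<integral>\<^sup>+x. ennreal (exp (Z n x)) \<partial>M)"
        by (rule nn_integral_cmult) simp
      also have "\<dots> \<le> ennreal (exp (- b))"
        using mult_left_mono[OF exp_le[of n], of "ennreal (exp (- b))"] by simp
      finally show ?thesis .
    qed (rule trivial)
  qed
qed

text \<open>The maxima need not increase pointwise, but they increase in law. One step acts on test
  functions by \<open>\<psi>\<close>, which is the same for every \<open>n\<close> and preserves
  monotonicity, so the comparison of the first two terms, \<open>0\<close> and a nonnegative
  variable, propagates.\<close>

lemma lindley_stochastically_increasing:
  fixes \<phi> :: "real \<Rightarrow> ennreal"
  assumes indep: "indep_vars (\<lambda>_. borel) Z UNIV"
    and ident: "\<And>i. distr M borel (Z i) = distr M borel (Z 0)"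
    and "mono \<phi>"
    and "\<phi> \<in> borel_measurable borel"
  shows "(\<integral>\<^sup>+x. \<phi> (lindley Z n x) \<partial>M) \<le> (\<integral>\<^sup>+x. \<phi> (lindley Z (Suc n) x) \<partial>M)"
proof -
  have [measurable]: "Z i \<in> borel_measurable M" for i
    using indep by (auto simp: indep_vars_def)
  define \<psi> where "\<psi> \<phi> u = (\<integral>\<^sup>+y. \<phi> (max 0 (Z 0 y + u)) \<partial>M)" for \<phi> :: "real \<Rightarrow> ennreal" and u
  have step: "(\<integral>\<^sup>+x. \<phi> (lindley Z (Suc n) x) \<partial>M) = (\<integral>\<^sup>+x. \<psi> \<phi> (lindley Z n x) \<partial>M)"
    if [measurable]: "\<phi> \<in> borel_measurable borel" for \<phi> n
  proof -
    have "(\<integral>\<^sup>+x. \<phi> (lindley Z (Suc n) x) \<partial>M)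
        = (\<integral>\<^sup>+x. (\<lambda>p. \<phi> (max 0 (snd p + fst p))) (lindley Z n x, Z n x) \<partial>M)"
      by simp
    also have "\<dots> = (\<integral>\<^sup>+x. \<integral>\<^sup>+y. (\<lambda>p. \<phi> (max 0 (snd p + fst p))) (lindley Z n x, Z n y) \<partial>M \<partial>M)"
      by (rule nn_integral_indep_var[OF indep_var_lindley(1)[OF indep]]) measurable
    also have "\<dots> = (\<integral>\<^sup>+x. \<psi> \<phi> (lindley Z n x) \<partial>M)"
    proof (intro nn_integral_cong)
      fix x
      define u where "u = lindley Z n x"
      have "(\<integral>\<^sup>+y. \<phi> (max 0 (Z n y + u)) \<partial>M) = (\<integral>\<^sup>+z. \<phi> (max 0 (z + u)) \<partial>distr M borel (Z n))"
        by (simp add: nn_integral_distr)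
      also have "\<dots> = (\<integral>\<^sup>+z. \<phi> (max 0 (z + u)) \<partial>distr M borel (Z 0))"
        by (subst ident[of n]) (rule refl)
      also have "\<dots> = \<psi> \<phi> u"
        by (simp add: nn_integral_distr \<psi>_def)
      finally show "(\<integral>\<^sup>+y. (\<lambda>p. \<phi> (max 0 (snd p + fst p))) (lindley Z n x, Z n y) \<partial>M)
          = \<psi> \<phi> (lindley Z n x)"
        by (simp add: u_def)
    qed
    finally show ?thesis .
  qed
  have mono_\<psi>: "mono (\<psi> \<phi>)" if "mono \<phi>" for \<phi>
    unfolding \<psi>_def mono_def by (auto intro!: nn_integral_mono monoD[OF that])
  have meas_\<psi>: "\<psi> \<phi> \<in> borel_measurable borel" if [measurable]: "\<phi> \<in> borel_measurable borel" for \<phi>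
    unfolding \<psi>_def by (rule borel_measurable_nn_integral) measurable
  show ?thesis
    using \<open>mono \<phi>\<close> \<open>\<phi> \<in> borel_measurable borel\<close>
  proof (induction n arbitrary: \<phi>)
    case 0
    show ?case
      by (intro nn_integral_mono) (auto intro: monoD[OF 0(1)])
  next
    case (Suc n)
    show ?case
      using Suc.IH[OF mono_\<psi>[OF Suc.prems(1)] meas_\<psi>[OF Suc.prems(2)]]
      by (simp only: step[OF Suc.prems(2)])
  qed
qed

lemma integrable_lindley:
  assumes "\<And>i. integrable M (Z i)"
  shows "integrable M (lindley Z n)"
proof (induction n)
  case (Suc n)
  show ?case
    unfolding lindley.simps by (intro integrable_max Bochner_Integration.integrable_add assms Suc) simp
qed simp

text \<open>Garsia's argument: with \<open>Z i = Y i - C\<close>, the recursion gives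
  \<open>lindley Z (Suc m) \<le> Y m + lindley Z m - C\<close> on the event \<open>lindley Z (Suc m) > 0\<close> and
  \<open>lindley Z (Suc m) \<le> Y m + lindley Z m\<close> off it; take expectations, which increase along
  \<open>lindley Z\<close>.\<close>

lemma prob_suffix_average_gt:
  fixes Y :: "nat \<Rightarrow> 'a \<Rightarrow> real"
  assumes indep: "indep_vars (\<lambda>_. borel) Y UNIV"
    and ident: "\<And>i. distr M borel (Y i) = distr M borel (Y 0)"
    and nonneg: "\<And>i x. Y i x \<ge> 0"
    and integrable: "integrable M (Y 0)"
    and "C > 0"
  shows "prob {x\<in>space M. \<exists>j\<in>{1..n}. (\<Sum>i=1..j. Y (n - i) x) > C * real j}
    \<le> expectation (Y 0) / C"
proof (cases n)
  case 0
  with \<open>C > 0\<close> show ?thesis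
    by (simp add: Bochner_Integration.integral_nonneg nonneg)
next
  case (Suc m)
  have Y [measurable]: "Y i \<in> borel_measurable M" for i
    using indep by (auto simp: indep_vars_def)
  have int_Y: "integrable M (Y i)" for i
    using integrable identically_distributed(1)[OF Y Y ident[of i] measurable_ident_sets[OF refl]] by blast
  have exp_Y: "expectation (Y i) = expectation (Y 0)" for i
    by (rule identically_distributed(2)[OF Y Y ident measurable_ident_sets[OF refl]])
  define Z where "Z i x = Y i x - C" for i x
  have int_L: "integrable M (lindley Z k)" for k
    by (rule integrable_lindley) (simp add: Z_def[abs_def] int_Y)
  have [measurable]: "Z i \<in> borel_measurable M" for i
    unfolding Z_def by measurable
  have "indep_vars (\<lambda>_. borel) Z UNIV"
    unfolding Z_def[abs_def] by (rule indep_vars_compose2[OF indep]) simp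
  moreover have "distr M borel (Z i) = distr M borel (Z 0)" for i
    unfolding Z_def[abs_def] by (rule identically_distributed(3)[OF _ _ ident]) simp_all
  ultimately have "(\<integral>\<^sup>+x. ennreal (lindley Z m x) \<partial>M) \<le> (\<integral>\<^sup>+x. ennreal (lindley Z (Suc m) x) \<partial>M)"
    by (rule lindley_stochastically_increasing) (auto simp: mono_def intro: ennreal_leI)
  then have L_mono: "expectation (lindley Z m) \<le> expectation (lindley Z (Suc m))"
    by (simp only: nn_integral_eq_integral[OF int_L] lindley_nonneg AE_I2 ennreal_le_iff
        Bochner_Integration.integral_nonneg)
  let ?B = "{x\<in>space M. 0 < lindley Z (Suc m) x}"
  have "?B \<in> events"
    by measurable
  then have int_B: "integrable M (\<lambda>x. C * indicator ?B x)"
    by (intro integrable_mult_right integrable_real_indicator) (auto simp: emeasure_eq_measure)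
  have "expectation (lindley Z (Suc m))
      \<le> expectation (\<lambda>x. Y m x + lindley Z m x - C * indicator ?B x)"
  proof (intro integral_mono int_L)
    fix x
    assume "x \<in> space M"
    then show "lindley Z (Suc m) x \<le> Y m x + lindley Z m x - C * indicator ?B x"
      using lindley_nonneg[of Z m x] nonneg[of m x]
      by (cases "Z m x + lindley Z m x > 0") (auto simp: Z_def)
  qed (intro Bochner_Integration.integrable_add Bochner_Integration.integrable_diff int_Y int_L int_B)
  also have "\<dots> = expectation (\<lambda>x. Y m x + lindley Z m x) - expectation (\<lambda>x. C * indicator ?B x)"
    by (intro Bochner_Integration.integral_diff Bochner_Integration.integrable_add int_Y int_L int_B)
  also have "expectation (\<lambda>x. Y m x + lindley Z m x) = expectation (Y 0) + expectation (lindley Z m)"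
    by (subst Bochner_Integration.integral_add[OF int_Y int_L]) (simp only: exp_Y[of m])
  also have "expectation (\<lambda>x. C * indicator ?B x) = C * prob ?B"
    using \<open>?B \<in> events\<close> by (simp del: lindley.simps)
  finally have "C * prob ?B \<le> expectation (Y 0)"
    using L_mono by linarith
  then have "prob ?B \<le> expectation (Y 0) / C"
    using \<open>C > 0\<close> by (simp add: field_simps)
  \<comment> \<open>A suffix average of \<open>Y\<close> above \<open>C\<close> is a positive suffix
    sum of \<open>Z\<close>, and that sum lies below \<open>lindley Z n\<close> with
    \<open>n = Suc m\<close>.\<close>
  moreover have "prob {x\<in>space M. \<exists>j\<in>{1..n}. (\<Sum>i=1..j. Y (n - i) x) > C * real j} \<le> prob ?B"
  proof (rule finite_measure_mono)
    show "{x\<in>space M. \<exists>j\<in>{1..n}. (\<Sum>i=1..j. Y (n - i) x) > C * real j} \<subseteq> ?B"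
    proof clarify
      fix x j
      assume "j \<in> {1..n}" and gt: "(\<Sum>i=1..j. Y (n - i) x) > C * real j"
      then have "(\<Sum>i=1..j. Z (n - i) x) \<le> lindley Z n x"
        by (intro suffix_sum_le_lindley) simp
      then show "0 < lindley Z (Suc m) x"
        using gt by (simp add: Z_def sum_subtractf Suc mult.commute)
    qed
  qed (rule \<open>?B \<in> events\<close>)
  ultimately show ?thesis
    by linarith
qed

end

section \<open>Elementary inequalities for exponentials and iterated logarithms\<close>

lemma exp_diff_square_le:
  fixes y :: real
  shows "exp (y - y\<^sup>2) \<le> 1 + y + y\<^sup>2"
proof -
  have pos: "1 - y + y\<^sup>2 > 0"
    using zero_le_power2[of "y - 1/2"] by (simp add: power2_eq_square algebra_simps)
  \<comment> \<open>The reciprocal of the left side is at least \<open>1 - y + y^2\<close>, whose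
    product with \<open>1 + y + y^2\<close> is \<open>1 + y^2 + y^4 \<ge> 1\<close> for every real
    \<open>y\<close>.\<close>
  have "1 - y + y\<^sup>2 \<le> exp (- (y - y\<^sup>2))"
    using exp_ge_add_one_self[of "- (y - y\<^sup>2)"] by (simp add: algebra_simps)
  then have "exp (y - y\<^sup>2) * (1 - y + y\<^sup>2) \<le> exp (y - y\<^sup>2) * exp (- (y - y\<^sup>2))"
    by (intro mult_left_mono) auto
  also have "\<dots> = 1"
    by (simp flip: exp_add)
  also have "1 \<le> 1 + y ^ 2 + (y ^ 2) ^ 2"
    by simp
  also have "\<dots> = (1 + y + y\<^sup>2) * (1 - y + y\<^sup>2)"
    by (simp add: power2_eq_square algebra_simps)
  finally show ?thesis
    using pos by simp
qed

text \<open>Telescoping comparison; it bounds the total weight of the dyadic blocks in a union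
  bound.\<close>

lemma sum_inverse_squares_le: "(\<Sum>m<N. 1 / (real m + 3)\<^sup>2) \<le> 1 - 1 / (real N + 2)"
proof (induction N)
  case (Suc N)
  have "1 / (real N + 3)\<^sup>2 \<le> 1 / ((real N + 2) * (real N + 3))"
    unfolding power2_eq_square by (intro divide_left_mono mult_right_mono) auto
  also have "\<dots> = 1 / (real N + 2) - 1 / (real N + 3)"
    by (simp add: field_simps)
  finally show ?case
    using Suc by (simp add: add.commute)
qed simp

text \<open>Converts the weight of a dyadic block into \<open>loglog j\<close>. Below
  \<open>4\<close> the convention \<open>loglog = 1\<close> suffices. Otherwise
  \<open>ln j \<ge> 2 m / 3\<close>, and \<open>m + 3\<close> is at most the eighth power of
  \<open>2 m / 3\<close>; the outer logarithm turns the exponent into the factor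
  \<open>8\<close>.\<close>

lemma ln_le_loglog:
  assumes "2 ^ m \<le> j" "j < 2 ^ Suc m"
  shows "ln (real m + 3) \<le> 8 * loglog (real j)"
proof (cases "j < 4")
  case True
  then have "m < 2"
    using assms(1) power_increasing[of 2 m "2::nat"] by (cases "m < 2") auto
  then have "ln (real m + 3) \<le> ln 4"
    by (subst ln_le_cancel_iff) auto
  also have "ln 4 \<le> (4::real) - 1"
    by (rule ln_le_minus_one) simp
  finally show ?thesis
    using True by (simp add: loglog_def)
next
  case False
  then have "2 \<le> m"
    using assms(2) power_increasing[of "Suc m" 2 "2::nat"] by (cases "m < 2") auto
  have "2 / 3 * real m \<le> real m * ln 2"
    using mult_left_mono[OF ln2_ge_two_thirds, of "real m"] by simp
  also have "\<dots> = ln (2 ^ m)"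
    by (simp add: ln_realpow)
  also have "\<dots> \<le> ln (real j)"
    using of_nat_mono[OF assms(1), where 'a = real] False by (subst ln_le_cancel_iff) auto
  finally have ln_j: "2 / 3 * real m \<le> ln (real j)" .
  \<comment> \<open>Here \<open>2 m / 3 \<ge> 4 / 3\<close> and \<open>(4 / 3) ^ 7 > 7\<close>, so
    seven of the eight factors absorb the passage from \<open>2 m / 3\<close> to
    \<open>m + 3\<close>.\<close>
  have "real m + 3 \<le> (4 / 3) ^ 7 * (2 / 3 * real m)"
    using \<open>2 \<le> m\<close> by (simp add: power_divide)
  also have "\<dots> \<le> (2 / 3 * real m) ^ 7 * (2 / 3 * real m)"
    using \<open>2 \<le> m\<close> by (intro mult_right_mono power_mono) auto
  also have "\<dots> = (2 / 3 * real m) ^ 8"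
    by (subst power_Suc2[symmetric]) simp
  also have "\<dots> \<le> ln (real j) ^ 8"
    using ln_j by (intro power_mono) auto
  finally have "real m + 3 \<le> ln (real j) ^ 8" .
  then have "ln (real m + 3) \<le> ln (ln (real j) ^ 8)"
    by (subst ln_le_cancel_iff) auto
  also have "\<dots> = 8 * ln (ln (real j))"
    using ln_j \<open>2 \<le> m\<close> by (subst ln_realpow) auto
  finally show ?thesis
    using False by (simp add: loglog_def)
qed

text \<open>The cutoff \<open>4\<close> lies beyond \<open>e\<close>:
  \<open>ln 4 = 2 ln 2 > 1\<close>, so the outer logarithm is positive there.\<close>

lemma loglog_pos: "loglog x > 0"
proof (cases "x < 4")
  case False
  have "1 < 2 * ln (2::real)"
    using ln2_ge_two_thirds by simp
  also have "\<dots> = ln 4"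
    using ln_realpow[of 2 2] by simp
  also have "\<dots> \<le> ln x"
    using False by (subst ln_le_cancel_iff) auto
  finally show ?thesis
    using False by (simp add: loglog_def)
qed (simp add: loglog_def)

text \<open>With \<open>\<theta>^2 = l / N\<close>, the quadratic penalty is at most
  \<open>2 (K + v) l\<close>, comparable to the threshold \<open>a * l\<close>. Squaring the
  resulting bound on \<open>\<theta> * s\<close> and dividing by \<open>\<theta>^2\<close> gives the
  scale \<open>N * l\<close>. Allowing \<open>j\<close> up to \<open>2 * N\<close> lets one
  \<open>\<theta>\<close> serve a whole dyadic block.\<close>

lemma square_le_of_self_normalized:
  fixes s V :: real
  assumes "N > 0" "l > 0" "V \<le> K * real j" "0 \<le> K + v" "real j \<le> 2 * N" "0 \<le> a"
    and "\<theta> = sqrt (l / N)"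
    and less: "\<bar>\<theta> * s\<bar> - \<theta>\<^sup>2 * (V + real j * v) < a * l"
  shows "s\<^sup>2 \<le> (a + 2 * (K + v))\<^sup>2 * (N * l)"
proof -
  have lam: "\<theta>\<^sup>2 = l / N"
    using assms by simp
  have "V + real j * v \<le> (K + v) * real j"
    using assms(3) by (simp add: algebra_simps)
  also have "\<dots> \<le> (K + v) * (2 * N)"
    using assms by (intro mult_left_mono) auto
  finally have "l / N * (V + real j * v) \<le> l / N * ((K + v) * (2 * N))"
    using assms by (intro mult_left_mono) auto
  also have "\<dots> = 2 * (K + v) * l"
    using \<open>N > 0\<close> by simp
  finally have "\<bar>\<theta> * s\<bar> \<le> (a + 2 * (K + v)) * l"
    using less unfolding lam by (simp add: algebra_simps)
  then have "\<bar>\<theta> * s\<bar>\<^sup>2 \<le> ((a + 2 * (K + v)) * l)\<^sup>2"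
    by (intro power_mono) auto
  then have "l / N * s\<^sup>2 \<le> (a + 2 * (K + v))\<^sup>2 * l\<^sup>2"
    by (simp add: power_mult_distrib lam)
  then have "N / l * (l / N * s\<^sup>2) \<le> N / l * ((a + 2 * (K + v))\<^sup>2 * l\<^sup>2)"
    using assms by (intro mult_left_mono) auto
  then show ?thesis
    using assms by (simp add: power2_eq_square ac_simps)
qed

section \<open>Self-normalized inequalities and tightness of suffix sums\<close>

context prob_space
begin

text \<open>Subtracting the quadratic term makes the exponential moment at most 1 without any
  truncation of \<open>X\<close>, since \<open>exp (y - y\<^sup>2) \<le> 1 + y + y\<^sup>2\<close>.\<close>

lemma prob_self_normalized_suffix_sum_ge:
  fixes X :: "nat \<Rightarrow> 'a \<Rightarrow> real"
  assumes indep: "indep_vars (\<lambda>_. borel) X UNIV"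
    and ident: "\<And>i. distr M borel (X i) = distr M borel (X 0)"
    and int: "integrable M (X 0)" "integrable M (\<lambda>x. (X 0 x)\<^sup>2)"
    and mean: "expectation (X 0) = 0"
  shows "prob {x\<in>space M. \<exists>j\<in>{1..n}. a \<le> \<theta> * (\<Sum>i=1..j. X (n - i) x)
      - \<theta>\<^sup>2 * ((\<Sum>i=1..j. (X (n - i) x)\<^sup>2) + real j * expectation (\<lambda>x. (X 0 x)\<^sup>2))} \<le> exp (- a)"
    (is "prob ?E \<le> _")
proof -
  define v where "v = expectation (\<lambda>x. (X 0 x)\<^sup>2)"
  define h where "h y = \<theta> * y - \<theta>\<^sup>2 * (y\<^sup>2 + v)" for y
  define Z where "Z i x = h (X i x)" for i x
  have X [measurable]: "X i \<in> borel_measurable M" for i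
    using indep by (auto simp: indep_vars_def)
  have h [measurable]: "h \<in> borel_measurable borel"
    unfolding h_def by measurable
  have [measurable]: "Z i \<in> borel_measurable M" for i
    unfolding Z_def by measurable
  have indep_Z: "indep_vars (\<lambda>_. borel) Z UNIV"
    unfolding Z_def[abs_def] by (rule indep_vars_compose2[OF indep h])
  have exp_Z: "(\<integral>\<^sup>+x. ennreal (exp (Z i x)) \<partial>M) \<le> 1" for i
  proof -
    \<comment> \<open>\<open>c\<close> stems from the term with \<open>v\<close> in
      \<open>h\<close>. It compensates the expectation \<open>1 + \<theta>^2 v\<close> of the
      quadratic majorant, which is at most \<open>exp (\<theta>^2 v) = 1 / c\<close>.\<close>
    define c where "c = exp (- (\<theta>\<^sup>2 * v))"
    have "(\<integral>\<^sup>+x. ennreal (exp (Z i x)) \<partial>M) = (\<integral>\<^sup>+y. ennreal (exp (h y)) \<partial>distr M borel (X i))"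
      by (simp add: nn_integral_distr Z_def)
    also have "\<dots> = (\<integral>\<^sup>+y. ennreal (exp (h y)) \<partial>distr M borel (X 0))"
      by (subst ident[of i]) (rule refl)
    also have "\<dots> = (\<integral>\<^sup>+x. ennreal (exp (h (X 0 x))) \<partial>M)"
      by (simp add: nn_integral_distr)
    also have "\<dots> \<le> (\<integral>\<^sup>+x. ennreal (c * (1 + \<theta> * X 0 x + \<theta>\<^sup>2 * (X 0 x)\<^sup>2)) \<partial>M)"
    proof (intro nn_integral_mono ennreal_leI)
      fix x
      have "exp (h (X 0 x)) = c * exp (\<theta> * X 0 x - (\<theta> * X 0 x)\<^sup>2)"
        by (simp add: h_def c_def algebra_simps flip: exp_add)
      also have "\<dots> \<le> c * (1 + \<theta> * X 0 x + (\<theta> * X 0 x)\<^sup>2)"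
        by (intro mult_left_mono exp_diff_square_le) (simp add: c_def)
      finally show "exp (h (X 0 x)) \<le> c * (1 + \<theta> * X 0 x + \<theta>\<^sup>2 * (X 0 x)\<^sup>2)"
        by (simp add: power_mult_distrib)
    qed
    also have "\<dots> = ennreal (expectation (\<lambda>x. c * (1 + \<theta> * X 0 x + \<theta>\<^sup>2 * (X 0 x)\<^sup>2)))"
    proof (intro nn_integral_eq_integral AE_I2)
      show "integrable M (\<lambda>x. c * (1 + \<theta> * X 0 x + \<theta>\<^sup>2 * (X 0 x)\<^sup>2))"
        using int by simp
      fix x
      have "0 \<le> exp (\<theta> * X 0 x - (\<theta> * X 0 x)\<^sup>2)"
        by simp
      also have "\<dots> \<le> 1 + \<theta> * X 0 x + (\<theta> * X 0 x)\<^sup>2"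
        by (rule exp_diff_square_le)
      finally show "0 \<le> c * (1 + \<theta> * X 0 x + \<theta>\<^sup>2 * (X 0 x)\<^sup>2)"
        by (simp add: c_def power_mult_distrib)
    qed
    also have "expectation (\<lambda>x. c * (1 + \<theta> * X 0 x + \<theta>\<^sup>2 * (X 0 x)\<^sup>2)) = c * (1 + \<theta>\<^sup>2 * v)"
      using int mean by (simp add: v_def prob_space)
    also have "\<dots> \<le> c * exp (\<theta>\<^sup>2 * v)"
      using exp_ge_add_one_self[of "\<theta>\<^sup>2 * v"] by (intro mult_left_mono) (simp_all add: c_def)
    also have "\<dots> = 1"
      by (simp add: c_def flip: exp_add)
    finally show ?thesis
      by (simp add: ennreal_leI)
  qed
  have "prob ?E \<le> prob {x\<in>space M. a \<le> lindley Z n x}"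
  proof (rule finite_measure_mono)
    show "?E \<subseteq> {x\<in>space M. a \<le> lindley Z n x}"
    proof clarify
      fix x j
      assume "j \<in> {1..n}" and "a \<le> \<theta> * (\<Sum>i=1..j. X (n - i) x)
        - \<theta>\<^sup>2 * ((\<Sum>i=1..j. (X (n - i) x)\<^sup>2) + real j * expectation (\<lambda>x. (X 0 x)\<^sup>2))"
      then have "a \<le> (\<Sum>i=1..j. Z (n - i) x)"
        by (simp add: Z_def h_def v_def sum_subtractf sum.distrib flip: sum_distrib_left)
      also have "\<dots> \<le> lindley Z n x"
        using \<open>j \<in> {1..n}\<close> by (intro suffix_sum_le_lindley) simp
      finally show "a \<le> lindley Z n x" .
    qed
  qed measurable
  also have "\<dots> \<le> exp (- a)"
    using emeasure_lindley_ge[OF indep_Z exp_Z, of a n] by (simp add: emeasure_eq_measure)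
  finally show ?thesis .
qed

text \<open>Union of the one-sided events for \<open>\<theta>\<close> and \<open>- \<theta>\<close>;
  the penalty depends on \<open>\<theta>^2\<close> only and so serves both signs.\<close>

lemma prob_self_normalized_abs_suffix_sum_ge:
  fixes X :: "nat \<Rightarrow> 'a \<Rightarrow> real"
  assumes indep: "indep_vars (\<lambda>_. borel) X UNIV"
    and ident: "\<And>i. distr M borel (X i) = distr M borel (X 0)"
    and int: "integrable M (X 0)" "integrable M (\<lambda>x. (X 0 x)\<^sup>2)"
    and mean: "expectation (X 0) = 0"
  shows "prob {x\<in>space M. \<exists>j\<in>{1..n}. a \<le> \<bar>\<theta> * (\<Sum>i=1..j. X (n - i) x)\<bar>
      - \<theta>\<^sup>2 * ((\<Sum>i=1..j. (X (n - i) x)\<^sup>2) + real j * expectation (\<lambda>x. (X 0 x)\<^sup>2))} \<le> 2 * exp (- a)"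
proof -
  have [measurable]: "X i \<in> borel_measurable M" for i
    using indep by (auto simp: indep_vars_def)
  define E where "E \<theta> = {x\<in>space M. \<exists>j\<in>{1..n}. a \<le> \<theta> * (\<Sum>i=1..j. X (n - i) x)
      - \<theta>\<^sup>2 * ((\<Sum>i=1..j. (X (n - i) x)\<^sup>2) + real j * expectation (\<lambda>x. (X 0 x)\<^sup>2))}" for \<theta>
  have [measurable]: "E \<theta> \<in> events" for \<theta>
    unfolding E_def by measurable
  have "prob (E \<theta> \<union> E (- \<theta>)) \<le> prob (E \<theta>) + prob (E (- \<theta>))"
    by (rule measure_Un_le) simp_all
  also have "\<dots> \<le> exp (- a) + exp (- a)"
    unfolding E_def by (intro add_mono prob_self_normalized_suffix_sum_ge assms)
  finally have "prob (E \<theta> \<union> E (- \<theta>)) \<le> 2 * exp (- a)"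
    by simp
  moreover have "{x\<in>space M. \<exists>j\<in>{1..n}. a \<le> \<bar>\<theta> * (\<Sum>i=1..j. X (n - i) x)\<bar>
      - \<theta>\<^sup>2 * ((\<Sum>i=1..j. (X (n - i) x)\<^sup>2) + real j * expectation (\<lambda>x. (X 0 x)\<^sup>2))}
    \<subseteq> E \<theta> \<union> E (- \<theta>)"
    by (fastforce simp: E_def abs_if split: if_splits)
  ultimately show ?thesis
    using finite_measure_mono[of _ "E \<theta> \<union> E (- \<theta>)"] by (meson \<open>\<And>\<theta>. E \<theta> \<in> events\<close> order_trans sets.Un)
qed

text \<open>The third bound is the upper half of the law of the iterated logarithm.  It comes from
  the self-normalized inequality on each dyadic block \<open>2 ^ m \<le> j < 2 ^ Suc m\<close>, with
  \<open>\<theta>\<^sup>2 = ln (m + 3) / 2 ^ m\<close> and failure probability of order \<open>(m + 3) powr - (A + 2)\<close>.\<close>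

lemma suffix_sums_tight:
  fixes X :: "nat \<Rightarrow> 'a \<Rightarrow> real"
  assumes indep: "indep_vars (\<lambda>_. borel) X UNIV"
    and ident: "\<And>i. distr M borel (X i) = distr M borel (X 0)"
    and int: "integrable M (X 0)" "integrable M (\<lambda>x. (X 0 x)\<^sup>2)"
    and mean: "expectation (X 0) = 0"
    and "\<delta> > 0"
  obtains K D where "K > 0" "D > 0"
    and "\<And>n. \<exists>B\<in>events. prob B \<le> \<delta> \<and> (\<forall>x\<in>space M - B. \<forall>j\<in>{1..n}.
        (\<Sum>i=1..j. (X (n - i) x)\<^sup>2) \<le> K * real j \<and>
        (\<Sum>i=1..j. X (n - i) x)\<^sup>2 \<le> D * real n \<and>
        (\<Sum>i=1..j. X (n - i) x)\<^sup>2 \<le> D * (real j * loglog (real j)))"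
proof -
  have X [measurable]: "X i \<in> borel_measurable M" for i
    using indep by (auto simp: indep_vars_def)
  define v where "v = expectation (\<lambda>x. (X 0 x)\<^sup>2)"
  have "v \<ge> 0"
    unfolding v_def by (intro Bochner_Integration.integral_nonneg) simp
  \<comment> \<open>Makes the weak-type bound \<open>v / K\<close> at most
    \<open>\<delta> / 4\<close>; the \<open>+ 1\<close> keeps \<open>K\<close> positive when
    \<open>v = 0\<close>.\<close>
  define K where "K = 4 * (v + 1) / \<delta>"
  have "K > 0"
    using \<open>\<delta> > 0\<close> \<open>v \<ge> 0\<close> by (simp add: K_def)
  \<comment> \<open>Chosen so that \<open>2 * exp (- A) \<le> \<delta> / 4\<close>; the summand
    \<open>1\<close> ensures \<open>A \<ge> 0\<close>.\<close>
  define A where "A = ln (1 + 8 / \<delta>)"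
  have "A \<ge> 0"
    using \<open>\<delta> > 0\<close> by (simp add: A_def)
  have "exp (- A) = 1 / (1 + 8 / \<delta>)"
    using \<open>\<delta> > 0\<close> by (simp add: A_def exp_minus inverse_eq_divide add_pos_pos)
  also have "\<dots> \<le> \<delta> / 8"
    using \<open>\<delta> > 0\<close> by (simp add: field_simps)
  finally have exp_A: "2 * exp (- A) \<le> \<delta> / 4"
    by simp
  \<comment> \<open>The \<open>8\<close> comes from \<open>ln_le_loglog\<close>, the square from
    \<open>square_le_of_self_normalized\<close> with \<open>a = A + 2\<close>.\<close>
  define D where "D = 8 * (A + 2 + 2 * (K + v))\<^sup>2"
  have "D > 0"
    using \<open>A \<ge> 0\<close> \<open>K > 0\<close> \<open>v \<ge> 0\<close> by (auto simp: D_def)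
  define S where "S n j x = (\<Sum>i=1..j. X (n - i) x)" for n j x
  define V where "V n j x = (\<Sum>i=1..j. (X (n - i) x)\<^sup>2)" for n j x
  have [measurable]: "S n j \<in> borel_measurable M" "V n j \<in> borel_measurable M" for n j
    unfolding S_def V_def by measurable
  define E where "E n a \<theta> = {x\<in>space M. \<exists>j\<in>{1..n}.
      a \<le> \<bar>\<theta> * S n j x\<bar> - \<theta>\<^sup>2 * (V n j x + real j * v)}" for n a \<theta>
  have E [measurable]: "E n a \<theta> \<in> events" for n a \<theta>
    unfolding E_def by measurable
  have prob_E: "prob (E n a \<theta>) \<le> 2 * exp (- a)" for n a \<theta>
    unfolding E_def S_def V_def v_def
    by (rule prob_self_normalized_abs_suffix_sum_ge[OF indep ident int mean])
  define F where "F n = {x\<in>space M. \<exists>j\<in>{1..n}. V n j x > K * real j}" for n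
  have F [measurable]: "F n \<in> events" for n
    unfolding F_def by measurable
  have prob_F: "prob (F n) \<le> \<delta> / 4" for n
  proof -
    have "prob (F n) \<le> v / K"
      unfolding F_def V_def v_def
    proof (rule prob_suffix_average_gt)
      show "indep_vars (\<lambda>_. borel) (\<lambda>i x. (X i x)\<^sup>2) UNIV"
        by (rule indep_vars_compose2[OF indep]) simp
      show "distr M borel (\<lambda>x. (X i x)\<^sup>2) = distr M borel (\<lambda>x. (X 0 x)\<^sup>2)" for i
        by (rule identically_distributed(3)[OF X X ident]) simp
    qed (use int \<open>K > 0\<close> in auto)
    also have "\<dots> \<le> \<delta> / 4"
      using \<open>\<delta> > 0\<close> \<open>v \<ge> 0\<close> by (simp add: K_def field_simps)
    finally show ?thesis .
  qed
  define l where "l m = ln (real m + 3)" for m :: nat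
  have l_ge: "l m \<ge> 1" for m
  proof -
    have "1 = ln (exp 1 :: real)"
      by simp
    also have "\<dots> \<le> l m"
      unfolding l_def using exp_le by (subst ln_le_cancel_iff) auto
    finally show ?thesis .
  qed
  \<comment> \<open>The range \<open>m < n\<close> covers every block meeting \<open>{1..n}\<close>,
    since \<open>2 ^ m \<le> j \<le> n\<close> forces \<open>m < n\<close>. In the threshold,
    \<open>A\<close> buys the small probability, while \<open>2\<close> buys summability through
    \<open>exp (- 2 * l m) = 1 / (m + 3)^2\<close>.\<close>
  define G where "G n = (\<Union>m<n. E n ((A + 2) * l m) (sqrt (l m / 2 ^ m)))" for n
  have G [measurable]: "G n \<in> events" for n
    unfolding G_def by measurable
  have prob_G: "prob (G n) \<le> \<delta> / 4" for n
  proof -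
    have "prob (G n) \<le> (\<Sum>m<n. prob (E n ((A + 2) * l m) (sqrt (l m / 2 ^ m))))"
      unfolding G_def by (rule finite_measure_subadditive_finite) auto
    also have "\<dots> \<le> (\<Sum>m<n. 2 * exp (- A) * (1 / (real m + 3)\<^sup>2))"
    proof (rule sum_mono)
      fix m
      have "prob (E n ((A + 2) * l m) (sqrt (l m / 2 ^ m))) \<le> 2 * exp (- ((A + 2) * l m))"
        by (rule prob_E)
      also have "\<dots> \<le> 2 * exp (- A - 2 * l m)"
        using mult_left_mono[OF l_ge \<open>A \<ge> 0\<close>, of m] by (simp add: algebra_simps)
      also have "\<dots> = 2 * exp (- A) * (1 / (exp (l m))\<^sup>2)"
        by (simp add: exp_diff exp_double)
      also have "exp (l m) = real m + 3"
        by (simp add: l_def)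
      finally show "prob (E n ((A + 2) * l m) (sqrt (l m / 2 ^ m)))
        \<le> 2 * exp (- A) * (1 / (real m + 3)\<^sup>2)" .
    qed
    also have "\<dots> = 2 * exp (- A) * (\<Sum>m<n. 1 / (real m + 3)\<^sup>2)"
      by (simp add: sum_distrib_left)
    also have "\<dots> \<le> 2 * exp (- A) * 1"
    proof (rule mult_left_mono)
      have "(\<Sum>m<n. 1 / (real m + 3)\<^sup>2) \<le> 1 - 1 / (real n + 2)"
        by (rule sum_inverse_squares_le)
      also have "\<dots> \<le> 1"
        by simp
      finally show "(\<Sum>m<n. 1 / (real m + 3)\<^sup>2) \<le> 1" .
    qed simp
    finally show ?thesis
      using exp_A by simp
  qed
  show thesis
  proof (rule that[OF \<open>K > 0\<close> \<open>D > 0\<close>])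
    fix n
    \<comment> \<open>The single scale \<open>N = n\<close>, \<open>l = 1\<close> yields the bound
      \<open>D * n\<close>; \<open>G n\<close> handles the iterated logarithm. Each of the three
      events has probability at most \<open>\<delta> / 4\<close>.\<close>
    let ?H = "E n A (sqrt (1 / real n))"
    let ?B = "F n \<union> ?H \<union> G n"
    have "prob ?B \<le> prob (F n \<union> ?H) + prob (G n)"
      by (rule measure_Un_le) auto
    also have "prob (F n \<union> ?H) \<le> prob (F n) + prob ?H"
      by (rule measure_Un_le) auto
    finally have "prob ?B \<le> \<delta>"
      using prob_F[of n] prob_E[of n A "sqrt (1 / real n)"] prob_G[of n] exp_A \<open>\<delta> > 0\<close> by linarith
    moreover have "V n j x \<le> K * real j \<and> (S n j x)\<^sup>2 \<le> D * real n
        \<and> (S n j x)\<^sup>2 \<le> D * (real j * loglog (real j))"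
      if x: "x \<in> space M - ?B" and j: "j \<in> {1..n}" for x j
    proof (intro conjI)
      show V: "V n j x \<le> K * real j"
        using x j by (force simp: F_def)
      have E_D: "\<bar>\<theta> * S n j x\<bar> - \<theta>\<^sup>2 * (V n j x + real j * v) < a" if "x \<notin> E n a \<theta>" for a \<theta>
        using that x j by (force simp: E_def)
      have "0 \<le> K + v"
        using \<open>K > 0\<close> \<open>v \<ge> 0\<close> by simp
      have "(S n j x)\<^sup>2 \<le> (A + 2 * (K + v))\<^sup>2 * (real n * 1)"
        by (rule square_le_of_self_normalized[OF _ _ V \<open>0 \<le> K + v\<close> _ \<open>A \<ge> 0\<close> refl])
          (use x j E_D[of A "sqrt (1 / real n)"] in auto)
      also have "\<dots> \<le> D * real n"
      proof -
        have "(A + 2 * (K + v))\<^sup>2 \<le> (A + 2 + 2 * (K + v))\<^sup>2"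
          using \<open>A \<ge> 0\<close> \<open>0 \<le> K + v\<close> by (intro power_mono) auto
        also have "\<dots> \<le> D"
          by (simp add: D_def)
        finally show ?thesis
          by (simp add: mult_right_mono)
      qed
      finally show "(S n j x)\<^sup>2 \<le> D * real n" .
      obtain m where m: "2 ^ m \<le> j" "j < 2 ^ Suc m"
        using ex_power_ivl1[of 2 j] j by auto
      have "m < n"
        using less_le_trans[OF less_exp m(1)] j by simp
      have "(S n j x)\<^sup>2 \<le> (A + 2 + 2 * (K + v))\<^sup>2 * (2 ^ m * l m)"
      proof (rule square_le_of_self_normalized[OF _ _ V \<open>0 \<le> K + v\<close> _ _ refl])
        show "l m > 0"
          using l_ge[of m] by simp
        show "real j \<le> 2 * 2 ^ m"
          using of_nat_mono[of j "2 * 2 ^ m", where 'a = real] m(2) by simp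
        show "\<bar>sqrt (l m / 2 ^ m) * S n j x\<bar> - (sqrt (l m / 2 ^ m))\<^sup>2 * (V n j x + real j * v)
            < (A + 2) * l m"
          using x \<open>m < n\<close> by (intro E_D) (auto simp: G_def)
      qed (use \<open>A \<ge> 0\<close> in auto)
      also have "\<dots> \<le> (A + 2 + 2 * (K + v))\<^sup>2 * (real j * (8 * loglog (real j)))"
      proof (intro mult_left_mono mult_mono)
        show "2 ^ m \<le> real j"
          using of_nat_mono[OF m(1), where 'a = real] by simp
        show "l m \<le> 8 * loglog (real j)"
          unfolding l_def using m by (rule ln_le_loglog)
        show "0 \<le> l m"
          using l_ge[of m] by simp
      qed auto
      also have "\<dots> = D * (real j * loglog (real j))"
        by (simp add: D_def)
      finally show "(S n j x)\<^sup>2 \<le> D * (real j * loglog (real j))" .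
    qed
    ultimately show "\<exists>B\<in>events. prob B \<le> \<delta> \<and> (\<forall>x\<in>space M - B. \<forall>j\<in>{1..n}.
        (\<Sum>i=1..j. (X (n - i) x)\<^sup>2) \<le> K * real j \<and>
        (\<Sum>i=1..j. X (n - i) x)\<^sup>2 \<le> D * real n \<and>
        (\<Sum>i=1..j. X (n - i) x)\<^sup>2 \<le> D * (real j * loglog (real j)))"
      unfolding S_def V_def by (intro bexI[of _ ?B] conjI) auto
  qed
qed

end

section \<open>Unrolling the recursion and expanding the products\<close>

lemma prod_shift_reversed:
  fixes f :: "nat \<Rightarrow> 'b::comm_monoid_mult"
  shows "(\<Prod>i=1..Suc j. f (Suc n - i)) = f n * (\<Prod>i=1..j. f (n - i))"
proof -
  have "(\<Prod>i=1..Suc j. f (Suc n - i)) = f n * (\<Prod>i=Suc 1..Suc j. f (Suc n - i))"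
    by (subst prod.atLeast_Suc_atMost) auto
  also have "(\<Prod>i=Suc 1..Suc j. f (Suc n - i)) = (\<Prod>i=1..j. f (n - i))"
    by (subst prod.atLeast_Suc_atMost_Suc_shift) simp
  finally show ?thesis .
qed

text \<open>One more step multiplies every product by the newest coefficient and adds the empty
  product \<open>j = 0\<close>, the source of the leading \<open>1\<close> inside the factor of
  \<open>\<omega>\<close> in the theorem.\<close>

lemma affine_recurrence_solution:
  fixes s c :: "nat \<Rightarrow> 'b::comm_semiring_1"
  assumes "\<And>i. i < k \<Longrightarrow> s (Suc i) = b + c i * s i"
  shows "s k = s 0 * (\<Prod>i=1..k. c (k - i)) + b * (\<Sum>j<k. \<Prod>i=1..j. c (k - i))"
  using assms
proof (induction k)
  case (Suc k)
  have "s (Suc k) = b + c k * s k"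
    using Suc.prems by simp
  also have "s k = s 0 * (\<Prod>i=1..k. c (k - i)) + b * (\<Sum>j<k. \<Prod>i=1..j. c (k - i))"
    using Suc.prems by (intro Suc.IH) simp
  also have "b + c k * \<dots> = s 0 * (c k * (\<Prod>i=1..k. c (k - i)))
      + b * (1 + (\<Sum>j<k. c k * (\<Prod>i=1..j. c (k - i))))"
    by (simp add: algebra_simps flip: sum_distrib_left)
  also have "\<dots> = s 0 * (\<Prod>i=1..Suc k. c (Suc k - i)) + b * (\<Sum>j<Suc k. \<Prod>i=1..j. c (Suc k - i))"
    by (simp only: prod_shift_reversed[of c] sum.lessThan_Suc_shift) simp
  finally show ?case .
qed simp

lemma abs_exp_minus_taylor1_le:
  fixes z :: real
  assumes "\<bar>z\<bar> \<le> 1"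
  shows "\<bar>exp z - 1 - z\<bar> \<le> z\<^sup>2"
proof -
  have "exp z \<le> 1 + z + z\<^sup>2"
  proof (cases "z \<ge> 0")
    case True
    then show ?thesis
      using assms by (intro exp_bound) auto
  next
    case False
    have "(1 - z) * exp z \<le> exp (- z) * exp z"
      using exp_ge_add_one_self[of "- z"] by (intro mult_right_mono) auto
    also have "\<dots> = 1"
      by (simp flip: exp_add)
    \<comment> \<open>The right side is \<open>1 - z^3\<close>, and \<open>z\<close> is negative
      here.\<close>
    also have "1 \<le> (1 - z) * (1 + z + z\<^sup>2)"
    proof -
      have "0 \<le> - z * z\<^sup>2"
        using False by (intro mult_nonneg_nonneg) auto
      then show ?thesis
        by (simp add: power2_eq_square algebra_simps)
    qed
    finally show ?thesis
      using False by simp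
  qed
  then show ?thesis
    using exp_ge_add_one_self[of z] by linarith
qed

lemma abs_exp_minus_1_le:
  fixes z :: real
  assumes "\<bar>z\<bar> \<le> 1"
  shows "\<bar>exp z - 1\<bar> \<le> 2 * \<bar>z\<bar>"
proof -
  have "z\<^sup>2 \<le> \<bar>z\<bar>"
    using mult_left_mono[OF assms abs_ge_zero[of z]] by (simp add: power2_eq_square)
  then show ?thesis
    using abs_exp_minus_taylor1_le[OF assms] by linarith
qed

text \<open>After taking logarithms of the factors \<open>1 + u i\<close>, the two exponentials
  cancel the linear part exactly and leave \<open>exp Q\<close>, where \<open>Q\<close> sums terms
  of order \<open>(u i)^2\<close>.\<close>

lemma prod_one_plus_approx:
  fixes e :: "nat \<Rightarrow> real"
  assumes "finite I" and sq: "(\<Sum>i\<in>I. (e i)\<^sup>2) \<le> K * real (card I)" and "K \<ge> 0"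
    and small: "8 * (1 + K) * (real (card I) * (a\<^sup>2 + g\<^sup>2)) \<le> 1"
  shows "\<bar>(\<Prod>i\<in>I. 1 + g + a * e i) * exp (- (real (card I) * g)) * exp (- (a * (\<Sum>i\<in>I. e i))) - 1\<bar>
      \<le> 8 * (1 + K) * (real (card I) * (a\<^sup>2 + g\<^sup>2))"
proof -
  define u where "u i = g + a * e i" for i
  define Q where "Q = (\<Sum>i\<in>I. ln (1 + u i) - u i)"
  define m where "m = (1 + K) * (real (card I) * (a\<^sup>2 + g\<^sup>2))"
  have m: "8 * m \<le> 1"
    using small by (simp only: m_def mult.assoc)
  have "(\<Sum>i\<in>I. (u i)\<^sup>2) \<le> (\<Sum>i\<in>I. 2 * g\<^sup>2 + 2 * a\<^sup>2 * (e i)\<^sup>2)"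
  proof (rule sum_mono)
    fix i
    show "(u i)\<^sup>2 \<le> 2 * g\<^sup>2 + 2 * a\<^sup>2 * (e i)\<^sup>2"
      using zero_le_power2[of "g - a * e i"] unfolding u_def
      by (simp add: power2_eq_square algebra_simps)
  qed
  also have "\<dots> = 2 * real (card I) * g\<^sup>2 + 2 * a\<^sup>2 * (\<Sum>i\<in>I. (e i)\<^sup>2)"
    by (simp add: sum.distrib sum_distrib_left)
  also have "\<dots> \<le> 2 * real (card I) * g\<^sup>2 + 2 * a\<^sup>2 * (K * real (card I))"
    by (intro add_left_mono mult_left_mono sq) auto
  also have "\<dots> \<le> 2 * m"
    using \<open>K \<ge> 0\<close> by (simp add: m_def algebra_simps)
  finally have sum_u: "(\<Sum>i\<in>I. (u i)\<^sup>2) \<le> 2 * m" .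
  \<comment> \<open>The sum of squares controls each single term, which admits the quadratic bound
    for \<open>ln (1 + u i)\<close>.\<close>
  have u: "\<bar>u i\<bar> \<le> 1 / 2" if "i \<in> I" for i
  proof -
    have "(u i)\<^sup>2 \<le> (\<Sum>i\<in>I. (u i)\<^sup>2)"
      using that \<open>finite I\<close> by (intro member_le_sum) auto
    also have "\<dots> \<le> 1 / 4"
      using sum_u m by linarith
    finally have "(u i)\<^sup>2 \<le> (1 / 2)\<^sup>2"
      by (simp add: power_divide)
    then show ?thesis
      using abs_le_square_iff[of "u i" "1 / 2"] by simp
  qed
  have "\<bar>Q\<bar> \<le> (\<Sum>i\<in>I. \<bar>ln (1 + u i) - u i\<bar>)"
    unfolding Q_def by (rule sum_abs)
  also have "\<dots> \<le> (\<Sum>i\<in>I. 2 * (u i)\<^sup>2)"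
    by (intro sum_mono abs_ln_one_plus_x_minus_x_bound u)
  also have "\<dots> \<le> 4 * m"
    using sum_u by (simp flip: sum_distrib_left)
  finally have Q: "\<bar>Q\<bar> \<le> 4 * m" .
  have "(\<Prod>i\<in>I. 1 + g + a * e i) = (\<Prod>i\<in>I. exp (u i + (ln (1 + u i) - u i)))"
  proof (rule prod.cong)
    fix i
    assume "i \<in> I"
    then have "1 + u i > 0"
      using u[of i] by linarith
    then show "1 + g + a * e i = exp (u i + (ln (1 + u i) - u i))"
      by (simp add: u_def add.assoc)
  qed simp
  also have "\<dots> = exp (real (card I) * g + a * (\<Sum>i\<in>I. e i) + Q)"
    by (simp only: exp_sum[OF \<open>finite I\<close>, symmetric] sum.distrib Q_def u_def sum_constant sum_distrib_left)
  finally have "(\<Prod>i\<in>I. 1 + g + a * e i) * exp (- (real (card I) * g)) * exp (- (a * (\<Sum>i\<in>I. e i))) = exp Q"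
    by (simp flip: exp_add)
  moreover have "\<bar>exp Q - 1\<bar> \<le> 8 * m"
    using abs_exp_minus_1_le[of Q] Q m by linarith
  ultimately show ?thesis
    by (simp only: m_def mult.assoc)
qed

section \<open>Criteria for maxima and boundedness in probability\<close>

lemma abs_MAX_le:
  fixes f :: "'b \<Rightarrow> real"
  assumes "finite I" "I \<noteq> {}" "\<And>i. i \<in> I \<Longrightarrow> \<bar>f i\<bar> \<le> c"
  shows "\<bar>MAX i\<in>I. f i\<bar> \<le> c"
proof -
  have "(MAX i\<in>I. f i) \<in> f ` I"
    using assms by (intro Max_in) auto
  then show ?thesis
    using assms(3) by auto
qed

text \<open>The tail event is enclosed in \<open>B\<close>, and monotonicity of the measure asks for
  measurability of \<open>B\<close> only, so a maximum \<open>X n\<close> can be handled through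
  pointwise bounds.\<close>

lemma (in prob_space) bigO_P_I:
  assumes "\<And>\<delta>. \<delta> > 0 \<Longrightarrow> \<exists>C>0. \<forall>\<^sub>F n in sequentially.
    \<exists>B\<in>events. prob B \<le> \<delta> \<and> (\<forall>x\<in>space M - B. \<bar>X n x\<bar> \<le> C * \<bar>a n\<bar>)"
  shows "bigO_P M X a"
  unfolding bigO_P_def
proof (intro allI impI)
  fix \<delta> :: real
  assume "\<delta> > 0"
  from assms[OF this] obtain C where "C > 0" and C: "\<forall>\<^sub>F n in sequentially.
    \<exists>B\<in>events. prob B \<le> \<delta> \<and> (\<forall>x\<in>space M - B. \<bar>X n x\<bar> \<le> C * \<bar>a n\<bar>)"
    by blast
  from C have "\<forall>\<^sub>F n in sequentially. prob {x\<in>space M. \<bar>X n x\<bar> > C * \<bar>a n\<bar>} \<le> \<delta>"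
  proof eventually_elim
    case (elim n)
    then obtain B where B: "B \<in> events" "prob B \<le> \<delta>"
      and le: "\<And>x. x \<in> space M - B \<Longrightarrow> \<bar>X n x\<bar> \<le> C * \<bar>a n\<bar>"
      by blast
    have "{x\<in>space M. \<bar>X n x\<bar> > C * \<bar>a n\<bar>} \<subseteq> B"
      using le by (force simp: not_le[symmetric])
    from finite_measure_mono[OF this B(1)] B(2) show ?case
      by linarith
  qed
  with \<open>C > 0\<close> show "\<exists>C>0. \<forall>\<^sub>F n in sequentially. prob {x\<in>space M. \<bar>X n x\<bar> > C * \<bar>a n\<bar>} \<le> \<delta>"
    by blast
qed

section \<open>The expansion and its remainder bounds\<close>

theorem proposition2p1:
  fixes M :: "'a measure"
    and \<epsilon> :: "nat \<Rightarrow> 'a \<Rightarrow> real"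
    and \<omega> \<sigma>\<^sub>0 t :: real
    and \<alpha> \<beta> \<gamma> :: "nat \<Rightarrow> real"
    and \<sigma> y :: "nat \<Rightarrow> nat \<Rightarrow> 'a \<Rightarrow> real"
    and \<xi> :: "nat \<Rightarrow> 'a \<Rightarrow> real"
    and k :: "nat \<Rightarrow> nat"
  defines "\<gamma> \<equiv> \<lambda>n. \<alpha> n + \<beta> n - 1"
    and "\<xi> \<equiv> \<lambda>j x. (\<epsilon> j x)\<^sup>2 - 1"
    and "k \<equiv> \<lambda>n. nat \<lfloor>real n * t\<rfloor>"
  assumes "prob_space M"
    and indep: "prob_space.indep_vars M (\<lambda>_. borel) \<epsilon> UNIV"
    and ident: "\<And>i. distr M borel (\<epsilon> i) = distr M borel (\<epsilon> 0)"
    and nondeg: "nondegenerate_distribution (distr M borel (\<lambda>x. (\<epsilon> 0 x)\<^sup>2))"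
    and \<omega>_pos: "\<omega> > 0"
    and \<alpha>_nonneg: "\<And>n. n \<ge> 1 \<Longrightarrow> \<alpha> n \<ge> 0"
    and \<beta>_nonneg: "\<And>n. n \<ge> 1 \<Longrightarrow> \<beta> n \<ge> 0"
    and \<alpha>_lim: "\<alpha> \<longlonglongrightarrow> 0"
    and \<beta>_lim: "\<beta> \<longlonglongrightarrow> 1"
    and \<sigma>_init: "\<And>n x. n \<ge> 1 \<Longrightarrow> x \<in> space M \<Longrightarrow> \<sigma> n 0 x = \<sigma>\<^sub>0"
    and y_eq: "\<And>n i x. n \<ge> 1 \<Longrightarrow> i \<le> n \<Longrightarrow> x \<in> space M \<Longrightarrow> y n i x = \<sigma> n i x * \<epsilon> i x"
    and \<sigma>_nonneg: "\<And>n i x. 1 \<le> i \<Longrightarrow> i \<le> n \<Longrightarrow> x \<in> space M \<Longrightarrow> \<sigma> n i x \<ge> 0"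
    and \<sigma>_rec: "\<And>n i x. 1 \<le> i \<Longrightarrow> i \<le> n \<Longrightarrow> x \<in> space M \<Longrightarrow>
        (\<sigma> n i x)\<^sup>2 = \<omega> + \<alpha> n * (y n (i - 1) x)\<^sup>2 + \<beta> n * (\<sigma> n (i - 1) x)\<^sup>2"
    and t: "0 < t" "t \<le> 1"
    and second_moment: "prob_space.expectation M (\<lambda>x. (\<epsilon> 0 x)\<^sup>2) = 1"
    and fourth_moment: "integrable M (\<lambda>x. (\<epsilon> 0 x) ^ 4)"
    and "(\<lambda>n. sqrt (real n) * \<alpha> n) \<longlonglongrightarrow> 0"
    and "filterlim (\<lambda>n. real n * \<alpha> n) at_top sequentially"
    and "(\<lambda>n. sqrt (real n) * \<gamma> n) \<longlonglongrightarrow> 0"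
  shows "\<exists>(R1 :: nat \<Rightarrow> 'a \<Rightarrow> real) (R2 :: nat \<Rightarrow> nat \<Rightarrow> 'a \<Rightarrow> real)
          (R3 :: nat \<Rightarrow> nat \<Rightarrow> 'a \<Rightarrow> real).
      (\<forall>n. R1 n \<in> borel_measurable M) \<and>
      (\<forall>n j. R2 n j \<in> borel_measurable M) \<and>
      (\<forall>n j. R3 n j \<in> borel_measurable M) \<and>
      (\<forall>n. k n \<ge> 1 \<longrightarrow> (\<forall>x\<in>space M.
         (\<sigma> n (k n) x)\<^sup>2 =
           \<sigma>\<^sub>0\<^sup>2 * exp (real (k n) * \<gamma> n) *
             (1 + \<alpha> n * (\<Sum>j=1..k n. \<xi> (k n - j) x) + R1 n x)
           + \<omega> * (1 + (\<Sum>j=1..k n - 1. exp (real j * \<gamma> n) *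
               (1 + \<alpha> n * (\<Sum>i=1..j. \<xi> (k n - i) x) + R2 n j x) * (1 + R3 n j x))))) \<and>
      bigO_P M (\<lambda>n x. \<bar>R1 n x\<bar>) (\<lambda>n. real (k n) * ((\<alpha> n)\<^sup>2 + (\<gamma> n)\<^sup>2)) \<and>
      bigO_P M (\<lambda>n x. MAX j\<in>{1..k n}. \<bar>R2 n j x\<bar>) (\<lambda>n. real (k n) * (\<alpha> n)\<^sup>2) \<and>
      bigO_P M (\<lambda>n x. MAX j\<in>{1..k n}. 1 / (real j * loglog (real j)) * \<bar>R2 n j x\<bar>)
        (\<lambda>n. (\<alpha> n)\<^sup>2) \<and>
      bigO_P M (\<lambda>n x. MAX j\<in>{1..k n}. 1 / real j * \<bar>R3 n j x\<bar>)
        (\<lambda>n. (\<alpha> n)\<^sup>2 + (\<gamma> n)\<^sup>2)"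
proof -
  interpret prob_space M
    by fact
  have \<epsilon> [measurable]: "\<epsilon> i \<in> borel_measurable M" for i
    using indep by (auto simp: indep_vars_def)
  have \<xi> [measurable]: "\<xi> i \<in> borel_measurable M" for i
    unfolding \<xi>_def by measurable
  have indep_\<xi>: "indep_vars (\<lambda>_. borel) \<xi> UNIV"
    unfolding \<xi>_def by (rule indep_vars_compose2[OF indep]) simp
  have ident_\<xi>: "distr M borel (\<xi> i) = distr M borel (\<xi> 0)" for i
    unfolding \<xi>_def by (rule identically_distributed(3)[OF \<epsilon> \<epsilon> ident]) simp
  \<comment> \<open>A non-integrable function would have expectation \<open>0\<close> by default,
    not \<open>1\<close>.\<close>
  have int_sq: "integrable M (\<lambda>x. (\<epsilon> 0 x)\<^sup>2)"
    using second_moment not_integrable_integral_eq[of M "\<lambda>x. (\<epsilon> 0 x)\<^sup>2"] by fastforce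
  have int_\<xi>: "integrable M (\<xi> 0)" and mean_\<xi>: "expectation (\<xi> 0) = 0"
    using int_sq second_moment by (simp_all add: \<xi>_def prob_space)
  have int_\<xi>_sq: "integrable M (\<lambda>x. (\<xi> 0 x)\<^sup>2)"
  proof -
    have "(\<lambda>x. (\<xi> 0 x)\<^sup>2) = (\<lambda>x. \<epsilon> 0 x ^ 4 - 2 * (\<epsilon> 0 x)\<^sup>2 + 1)"
      by (simp add: \<xi>_def fun_eq_iff power2_eq_square power4_eq_xxxx algebra_simps)
    then show ?thesis
      using int_sq fourth_moment by simp
  qed

  define b where "b n = (\<alpha> n)\<^sup>2 + (\<gamma> n)\<^sup>2" for n
  have n_\<alpha>: "(\<lambda>n. real n * (\<alpha> n)\<^sup>2) \<longlonglongrightarrow> 0"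
    using tendsto_power[OF \<open>(\<lambda>n. sqrt (real n) * \<alpha> n) \<longlonglongrightarrow> 0\<close>, of 2] by (simp add: power_mult_distrib)
  have n_\<gamma>: "(\<lambda>n. real n * (\<gamma> n)\<^sup>2) \<longlonglongrightarrow> 0"
    using tendsto_power[OF \<open>(\<lambda>n. sqrt (real n) * \<gamma> n) \<longlonglongrightarrow> 0\<close>, of 2] by (simp add: power_mult_distrib)
  have n_b: "(\<lambda>n. real n * b n) \<longlonglongrightarrow> 0"
    using tendsto_add[OF n_\<alpha> n_\<gamma>] by (simp add: b_def distrib_left)
  have k_le: "k n \<le> n" for n
  proof -
    have "real n * t \<le> real n"
      using t by (simp add: mult_left_le)
    then show ?thesis
      unfolding k_def by linarith
  qed
  \<comment> \<open>Ensures that the index range of each \<open>MAX\<close> is eventually nonempty,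
    as the maximum of an empty set is unspecified.\<close>
  have k_ge: "\<forall>\<^sub>F n in sequentially. k n \<ge> 1"
    using eventually_ge_at_top[of "nat \<lceil>1 / t\<rceil>"]
  proof eventually_elim
    case (elim n)
    then have "1 / t \<le> real n"
      by linarith
    then have "1 \<le> real n * t"
      using t by (simp add: field_simps)
    then show ?case
      unfolding k_def by linarith
  qed

  define S where "S n j x = (\<Sum>i=1..j. \<xi> (k n - i) x)" for n j x
  define P where "P n j x = (\<Prod>i=1..j. 1 + \<gamma> n + \<alpha> n * \<xi> (k n - i) x)" for n j x
  \<comment> \<open>\<open>R1\<close> is forced by the first summand of the expansion;
    \<open>R1_eq\<close> reduces it to \<open>R2\<close> and \<open>R3\<close> at
    \<open>j = k n\<close>.\<close>
  define R1 where "R1 n x = P n (k n) x * exp (- (real (k n) * \<gamma> n)) - 1 - \<alpha> n * S n (k n) x" for n x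
  define R2 where "R2 n j x = exp (\<alpha> n * S n j x) - 1 - \<alpha> n * S n j x" for n j x
  define R3 where "R3 n j x = P n j x * exp (- (real j * \<gamma> n)) * exp (- (\<alpha> n * S n j x)) - 1" for n j x
  have P_eq: "P n j x = exp (real j * \<gamma> n) * (1 + \<alpha> n * S n j x + R2 n j x) * (1 + R3 n j x)" for n j x
    by (simp add: R2_def R3_def exp_minus field_simps)
  have R1_eq: "R1 n x = R2 n (k n) x + R3 n (k n) x * (1 + \<alpha> n * S n (k n) x + R2 n (k n) x)" for n x
    by (simp add: R1_def R2_def R3_def exp_minus field_simps)
  have [measurable]: "S n j \<in> borel_measurable M" "P n j \<in> borel_measurable M" for n j
    unfolding S_def P_def by measurable

  have expansion: "(\<sigma> n (k n) x)\<^sup>2 = \<sigma>\<^sub>0\<^sup>2 * exp (real (k n) * \<gamma> n) * (1 + \<alpha> n * S n (k n) x + R1 n x)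
      + \<omega> * (1 + (\<Sum>j=1..k n - 1. exp (real j * \<gamma> n) * (1 + \<alpha> n * S n j x + R2 n j x) * (1 + R3 n j x)))"
    if "k n \<ge> 1" "x \<in> space M" for n x
  proof -
    \<comment> \<open>The coefficient of the squared volatility is \<open>\<alpha> \<epsilon>^2 +
      \<beta> = 1 + \<gamma> + \<alpha> \<xi>\<close>.\<close>
    have "(\<sigma> n (Suc i) x)\<^sup>2 = \<omega> + (1 + \<gamma> n + \<alpha> n * \<xi> i x) * (\<sigma> n i x)\<^sup>2" if "i < k n" for i
      using that k_le[of n] \<sigma>_rec[of "Suc i" n x] y_eq[of n i x] \<open>x \<in> space M\<close>
      by (simp add: \<gamma>_def \<xi>_def power_mult_distrib algebra_simps)
    from affine_recurrence_solution[of "k n" "\<lambda>i. (\<sigma> n i x)\<^sup>2", OF this]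
    have "(\<sigma> n (k n) x)\<^sup>2 = (\<sigma> n 0 x)\<^sup>2 * P n (k n) x + \<omega> * (\<Sum>j<k n. P n j x)"
      by (simp add: P_def)
    moreover have "{..<k n} = insert 0 {1..k n - 1}"
      using that by auto
    then have "(\<Sum>j<k n. P n j x) = 1 + (\<Sum>j=1..k n - 1. P n j x)"
      by (simp add: P_def)
    moreover have "P n (k n) x = exp (real (k n) * \<gamma> n) * (1 + \<alpha> n * S n (k n) x + R1 n x)"
      by (simp add: R1_def exp_minus)
    moreover have "\<sigma> n 0 x = \<sigma>\<^sub>0"
      using that k_le[of n] by (intro \<sigma>_init) auto
    ultimately show ?thesis
      unfolding P_eq[symmetric] by (simp only: mult.assoc)
  qed

  \<comment> \<open>Collects all remainder bounds at one sample point, so that a single exceptional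
    event and a single constant serve the four claims.\<close>
  define controlled where "controlled C n x \<longleftrightarrow>
      \<bar>R1 n x\<bar> \<le> C * (real (k n) * b n) \<and>
      (\<forall>j\<in>{1..k n}. \<bar>R2 n j x\<bar> \<le> C * (real (k n) * (\<alpha> n)\<^sup>2) \<and>
        \<bar>R2 n j x\<bar> \<le> C * (\<alpha> n)\<^sup>2 * (real j * loglog (real j)) \<and>
        \<bar>R3 n j x\<bar> \<le> C * b n * real j)" for C n x
  have bounds: "\<exists>C>0. \<forall>\<^sub>F n in sequentially. k n \<ge> 1 \<and> (\<exists>B\<in>events. prob B \<le> \<delta> \<and> (\<forall>x\<in>space M - B. controlled C n x))"
    if "\<delta> > 0" for \<delta>
  proof -
    obtain K D where "K > 0" "D > 0"
      and KD: "\<And>n. \<exists>B\<in>events. prob B \<le> \<delta> \<and> (\<forall>x\<in>space M - B. \<forall>j\<in>{1..n}.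
        (\<Sum>i=1..j. (\<xi> (n - i) x)\<^sup>2) \<le> K * real j \<and>
        (\<Sum>i=1..j. \<xi> (n - i) x)\<^sup>2 \<le> D * real n \<and>
        (\<Sum>i=1..j. \<xi> (n - i) x)\<^sup>2 \<le> D * (real j * loglog (real j)))"
      by (rule suffix_sums_tight[OF indep_\<xi> ident_\<xi> int_\<xi> int_\<xi>_sq mean_\<xi> \<open>\<delta> > 0\<close>]) (rule that)
    \<comment> \<open>\<open>D\<close> comes from \<open>R2\<close>. In \<open>24 = 3 * 8\<close>,
      the \<open>8\<close> comes from \<open>R3\<close> and the \<open>3\<close> bounds the factor
      multiplying \<open>R3\<close> in \<open>R1_eq\<close>.\<close>
    define C where "C = D + 24 * (1 + K)"
    have "C > 0"
      using \<open>K > 0\<close> \<open>D > 0\<close> by (simp add: C_def)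
    \<comment> \<open>The two smallness conditions make \<open>prod_one_plus_approx\<close>
      applicable for all \<open>j \<le> k n\<close> and force
      \<open>\<bar>\<alpha> n * S n j x\<bar> \<le> 1\<close> off the exceptional event.\<close>
    have "\<forall>\<^sub>F n in sequentially. 8 * (1 + K) * (real n * b n) < 1"
      using tendsto_mult_right_zero[OF n_b, of "8 * (1 + K)"] by (rule order_tendstoD) simp
    moreover have "\<forall>\<^sub>F n in sequentially. D * (real n * (\<alpha> n)\<^sup>2) < 1"
      using tendsto_mult_right_zero[OF n_\<alpha>, of D] by (rule order_tendstoD) simp
    ultimately have "\<forall>\<^sub>F n in sequentially. k n \<ge> 1 \<and> (\<exists>B\<in>events. prob B \<le> \<delta> \<and> (\<forall>x\<in>space M - B. controlled C n x))"
      using k_ge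
    proof eventually_elim
      case (elim n)
      \<comment> \<open>Tightness is uniform in the length of the sums, so it may be invoked at
        length \<open>k n\<close>.\<close>
      obtain B where "B \<in> events" "prob B \<le> \<delta>"
        and good: "\<And>x j. x \<in> space M - B \<Longrightarrow> j \<in> {1..k n} \<Longrightarrow>
          (\<Sum>i=1..j. (\<xi> (k n - i) x)\<^sup>2) \<le> K * real j \<and>
          (S n j x)\<^sup>2 \<le> D * real (k n) \<and> (S n j x)\<^sup>2 \<le> D * (real j * loglog (real j))"
        using KD[of "k n"] unfolding S_def by blast
      have "b n \<ge> 0" and \<alpha>_b: "(\<alpha> n)\<^sup>2 \<le> b n"
        by (simp_all add: b_def)
      have R3: "\<bar>R3 n j x\<bar> \<le> 8 * (1 + K) * (real j * b n)"
        if x: "x \<in> space M - B" and j: "j \<in> {1..k n}" for x j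
      proof -
        have "8 * (1 + K) * (real j * b n) \<le> 8 * (1 + K) * (real n * b n)"
          using j k_le[of n] \<open>K > 0\<close> \<open>b n \<ge> 0\<close> by (intro mult_left_mono mult_right_mono) auto
        then have "8 * (1 + K) * (real j * b n) \<le> 1"
          using elim by linarith
        then show ?thesis
          using prod_one_plus_approx[of "{1..j}" "\<lambda>i. \<xi> (k n - i) x" K "\<alpha> n" "\<gamma> n"]
            good[OF x j] \<open>K > 0\<close>
          by (simp add: R3_def P_def S_def b_def)
      qed
      have R2: "\<bar>R2 n j x\<bar> \<le> (\<alpha> n)\<^sup>2 * (S n j x)\<^sup>2" and \<alpha>S: "\<bar>\<alpha> n * S n j x\<bar> \<le> 1"
        if x: "x \<in> space M - B" and j: "j \<in> {1..k n}" for x j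
      proof -
        have "(\<alpha> n * S n j x)\<^sup>2 = (\<alpha> n)\<^sup>2 * (S n j x)\<^sup>2"
          by (rule power_mult_distrib)
        also have "\<dots> \<le> (\<alpha> n)\<^sup>2 * (D * real (k n))"
          using good[OF x j] by (intro mult_left_mono) auto
        also have "\<dots> \<le> (\<alpha> n)\<^sup>2 * (D * real n)"
          using k_le[of n] \<open>D > 0\<close> by (intro mult_left_mono) auto
        also have "\<dots> \<le> 1"
          using elim by (simp add: ac_simps)
        finally show "\<bar>\<alpha> n * S n j x\<bar> \<le> 1"
          by (simp add: abs_square_le_1)
        from abs_exp_minus_taylor1_le[OF this] show "\<bar>R2 n j x\<bar> \<le> (\<alpha> n)\<^sup>2 * (S n j x)\<^sup>2"
          by (simp add: R2_def power_mult_distrib)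
      qed
      have R2_k: "\<bar>R2 n j x\<bar> \<le> D * (real (k n) * (\<alpha> n)\<^sup>2)"
        and R2_j: "\<bar>R2 n j x\<bar> \<le> D * (\<alpha> n)\<^sup>2 * (real j * loglog (real j))"
        if x: "x \<in> space M - B" and j: "j \<in> {1..k n}" for x j
        using R2[OF that] good[OF that] mult_left_mono[of "(S n j x)\<^sup>2" _ "(\<alpha> n)\<^sup>2"]
        by (force simp: ac_simps intro: order_trans)+
      have R1: "\<bar>R1 n x\<bar> \<le> C * (real (k n) * b n)" if x: "x \<in> space M - B" for x
      proof -
        have kn: "k n \<in> {1..k n}"
          using elim by simp
        have "D * (real (k n) * (\<alpha> n)\<^sup>2) \<le> D * (real n * (\<alpha> n)\<^sup>2)"
          using k_le[of n] \<open>D > 0\<close> by (intro mult_left_mono mult_right_mono) auto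
        then have "\<bar>R2 n (k n) x\<bar> \<le> 1"
          using R2_k[OF x kn] elim by linarith
        then have "\<bar>1 + \<alpha> n * S n (k n) x + R2 n (k n) x\<bar> \<le> 3"
          using \<alpha>S[OF x kn] by linarith
        then have "\<bar>R3 n (k n) x * (1 + \<alpha> n * S n (k n) x + R2 n (k n) x)\<bar> \<le> \<bar>R3 n (k n) x\<bar> * 3"
          unfolding abs_mult by (intro mult_left_mono) auto
        moreover have "\<bar>R2 n (k n) x\<bar> \<le> D * (real (k n) * b n)"
        proof (rule order_trans[OF R2_k[OF x kn]])
          show "D * (real (k n) * (\<alpha> n)\<^sup>2) \<le> D * (real (k n) * b n)"
            using \<open>D > 0\<close> \<alpha>_b by (intro mult_left_mono) auto
        qed
        ultimately have "\<bar>R1 n x\<bar> \<le> D * (real (k n) * b n) + 8 * (1 + K) * (real (k n) * b n) * 3"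
          unfolding R1_eq using R3[OF x kn] by linarith
        then show ?thesis
          by (simp add: C_def algebra_simps)
      qed
      have "D \<le> C" "8 * (1 + K) \<le> C"
        using \<open>K > 0\<close> \<open>D > 0\<close> by (simp_all add: C_def)
      have "\<bar>R2 n j x\<bar> \<le> C * (real (k n) * (\<alpha> n)\<^sup>2) \<and>
          \<bar>R2 n j x\<bar> \<le> C * (\<alpha> n)\<^sup>2 * (real j * loglog (real j)) \<and>
          \<bar>R3 n j x\<bar> \<le> C * b n * real j"
        if x: "x \<in> space M - B" and j: "j \<in> {1..k n}" for x j
      proof (intro conjI)
        show "\<bar>R2 n j x\<bar> \<le> C * (real (k n) * (\<alpha> n)\<^sup>2)"
          by (rule order_trans[OF R2_k[OF that]]) (intro mult_right_mono \<open>D \<le> C\<close>, simp)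
        show "\<bar>R2 n j x\<bar> \<le> C * (\<alpha> n)\<^sup>2 * (real j * loglog (real j))"
          by (rule order_trans[OF R2_j[OF that]])
            (use loglog_pos[of "real j"] in \<open>intro mult_right_mono \<open>D \<le> C\<close>, auto\<close>)
        have "8 * (1 + K) * (real j * b n) \<le> C * (real j * b n)"
          using \<open>b n \<ge> 0\<close> by (intro mult_right_mono \<open>8 * (1 + K) \<le> C\<close>) auto
        then show "\<bar>R3 n j x\<bar> \<le> C * b n * real j"
          using R3[OF that] by (simp add: ac_simps)
      qed
      with R1 have "\<forall>x\<in>space M - B. controlled C n x"
        unfolding controlled_def by blast
      with \<open>B \<in> events\<close> \<open>prob B \<le> \<delta>\<close> elim show ?case
        by blast
    qed
    with \<open>C > 0\<close> show ?thesis
      by blast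
  qed

  \<comment> \<open>Reduces each claim to a deterministic implication from
    \<open>controlled\<close>, with the same \<open>C\<close>.\<close>
  have O_P: "bigO_P M X a"
    if X: "\<And>C n x. k n \<ge> 1 \<Longrightarrow> controlled C n x \<Longrightarrow> \<bar>X n x\<bar> \<le> C * \<bar>a n\<bar>" for X a
  proof (rule bigO_P_I)
    fix \<delta> :: real
    assume "\<delta> > 0"
    from bounds[OF this] obtain C where "C > 0" and C: "\<forall>\<^sub>F n in sequentially. k n \<ge> 1 \<and>
        (\<exists>B\<in>events. prob B \<le> \<delta> \<and> (\<forall>x\<in>space M - B. controlled C n x))"
      by blast
    from C have "\<forall>\<^sub>F n in sequentially. \<exists>B\<in>events. prob B \<le> \<delta> \<and> (\<forall>x\<in>space M - B. \<bar>X n x\<bar> \<le> C * \<bar>a n\<bar>)"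
      by eventually_elim (use X in blast)
    with \<open>C > 0\<close> show "\<exists>C>0. \<forall>\<^sub>F n in sequentially.
        \<exists>B\<in>events. prob B \<le> \<delta> \<and> (\<forall>x\<in>space M - B. \<bar>X n x\<bar> \<le> C * \<bar>a n\<bar>)"
      by blast
  qed
  have "bigO_P M (\<lambda>n x. \<bar>R1 n x\<bar>) (\<lambda>n. real (k n) * ((\<alpha> n)\<^sup>2 + (\<gamma> n)\<^sup>2))"
    by (rule O_P) (simp add: controlled_def b_def)
  moreover have "bigO_P M (\<lambda>n x. MAX j\<in>{1..k n}. \<bar>R2 n j x\<bar>) (\<lambda>n. real (k n) * (\<alpha> n)\<^sup>2)"
    by (rule O_P, rule abs_MAX_le) (auto simp: controlled_def)
  moreover have "bigO_P M (\<lambda>n x. MAX j\<in>{1..k n}. 1 / (real j * loglog (real j)) * \<bar>R2 n j x\<bar>)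
      (\<lambda>n. (\<alpha> n)\<^sup>2)"
  proof (rule O_P, rule abs_MAX_le)
    fix C n x j
    assume "controlled C n x" and j: "j \<in> {1..k n}"
    then have "\<bar>R2 n j x\<bar> \<le> C * (\<alpha> n)\<^sup>2 * (real j * loglog (real j))"
      by (simp add: controlled_def)
    then show "\<bar>1 / (real j * loglog (real j)) * \<bar>R2 n j x\<bar>\<bar> \<le> C * \<bar>(\<alpha> n)\<^sup>2\<bar>"
      using j loglog_pos[of "real j"] by (simp add: abs_mult pos_divide_le_eq)
  qed auto
  moreover have "bigO_P M (\<lambda>n x. MAX j\<in>{1..k n}. 1 / real j * \<bar>R3 n j x\<bar>) (\<lambda>n. (\<alpha> n)\<^sup>2 + (\<gamma> n)\<^sup>2)"
  proof (rule O_P, rule abs_MAX_le)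
    fix C n x j
    assume "controlled C n x" and j: "j \<in> {1..k n}"
    then have "\<bar>R3 n j x\<bar> \<le> C * b n * real j"
      by (simp add: controlled_def)
    then show "\<bar>1 / real j * \<bar>R3 n j x\<bar>\<bar> \<le> C * \<bar>(\<alpha> n)\<^sup>2 + (\<gamma> n)\<^sup>2\<bar>"
      using j by (simp add: b_def abs_mult pos_divide_le_eq)
  qed auto
  moreover have "R1 n \<in> borel_measurable M" "R2 n j \<in> borel_measurable M" "R3 n j \<in> borel_measurable M" for n j
    unfolding R1_def R2_def R3_def by measurable
  ultimately show ?thesis
    using expansion unfolding S_def by (intro exI[of _ R1] exI[of _ R2] exI[of _ R3]) blast
qed

end
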